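(* The sets $\mathcal{K}_{\max}$, $\mathcal{R}$ and $\mathcal{F}$ are infinite subsets of $N_2$, each containing only finitely many elements of $N_1$. Moreover, $\mathcal{K}_{\min}$ is an infinite subset of $N_3$ containing infinitely many composite numbers. Here $\mathcal{K}_{\max}=\{K_{q,r}\colon q\text{ prime},\ q\equiv 3\pmod 4,\ r\in\mathbb{N}\}$, $\mathcal{K}_{\min}=\{k_{q,r}\colon q\text{ prime},\ q\equiv 3\pmod 4,\ r\in\mathbb{N}\}$, $\mathcal{R}=\{R(r_1,r_2)\colon r_1,r_2\in\mathbb{N},\ r_2>2\}$, and $\mathcal{F}=\{2^a\prod_{i=1}^k F_i\colon k\in H,\ a\in\mathbb{N},\ \text{and } a\le\log_2(F_{k+1}-1)\text{ if }F_{k+1}\text{ exists}\}$.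
   Context: $\phi$ is Euler's totient function, $V=\phi(\mathbb{N})$, $\phi^{-1}(m)=\{x\colon\phi(x)=m\}$. For $m\in V$: $N_1(m)=\max\{x\in\mathbb{N}\colon\phi(x)\le m\}$, $N_2(m)=\max\phi^{-1}(m)$, $N_3(m)=\min\phi^{-1}(m)$, and $N_i=\{N_i(m)\colon m\in V\}$. For a prime $q$ and $r,r_1,r_2\in\mathbb{N}$: $K_{q,r}=2q^{r+1}$; $k_{q,r}=q^r(q-1)+1$ if $q^r(q-1)+1$ is prime and $k_{q,r}=q^{r+1}$ otherwise; $R(r_1,r_2)=2\cdot 3^{r_1}\cdot 5^{r_2}$. A Fermat prime is a prime of the form $2^{2^l}+1$ with $l\ge 0$; $F_j$ denotes the $j$-th Fermat prime in increasing order ($F_1=3,F_2=5,F_3=17,\dots$), and $H=\{k\in\mathbb{N}\colon F_k\text{ exists}\}$. *)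

theory Defs
  imports Complex_Main "HOL-Library.Infinite_Set" "HOL-Number_Theory.Number_Theory"
begin

text \<open>Throughout, the natural numbers of the source are the positive integers; since
  \<^term>\<open>totient 0 = 0\<close>, zero is excluded explicitly below.\<close>

definition totient_values :: "nat set" where
  "totient_values = totient ` {0<..}"

definition totient_preimage :: "nat \<Rightarrow> nat set" where
  "totient_preimage m = {x. x > 0 \<and> totient x = m}"

text \<open>All sets to which \<^const>\<open>Max\<close> is applied are finite because \<^term>\<open>totient x\<close> tends to
  infinity with \<^term>\<open>x\<close>; they are nonempty for arguments in \<^const>\<open>totient_values\<close>.\<close>

definition N1 :: "nat \<Rightarrow> nat" where
  "N1 m = Max {x. x > 0 \<and> totient x \<le> m}"

definition N2 :: "nat \<Rightarrow> nat" where
  "N2 m = Max (totient_preimage m)"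

definition N3 :: "nat \<Rightarrow> nat" where
  "N3 m = Min (totient_preimage m)"

definition N1_set :: "nat set" where "N1_set = N1 ` totient_values"
definition N2_set :: "nat set" where "N2_set = N2 ` totient_values"
definition N3_set :: "nat set" where "N3_set = N3 ` totient_values"

definition K_big :: "nat \<Rightarrow> nat \<Rightarrow> nat" where
  "K_big q r = 2 * q ^ (r + 1)"

definition k_small :: "nat \<Rightarrow> nat \<Rightarrow> nat" where
  "k_small q r =
     (if prime (q ^ r * (q - 1) + 1) then q ^ r * (q - 1) + 1 else q ^ (r + 1))"

definition R_num :: "nat \<Rightarrow> nat \<Rightarrow> nat" where
  "R_num r1 r2 = 2 * 3 ^ r1 * 5 ^ r2"

definition fermat_primes :: "nat set" where
  "fermat_primes = {p. prime p \<and> (\<exists>l. p = 2 ^ (2 ^ l) + 1)}"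

text \<open>The Fermat primes are numbered from 1, whereas \<^const>\<open>enumerate\<close> starts at 0.
  The value is meaningful only for indices in \<open>H_set\<close> below.\<close>

definition nth_fermat_prime :: "nat \<Rightarrow> nat" where
  "nth_fermat_prime j = enumerate fermat_primes (j - 1)"

definition H_set :: "nat set" where
  "H_set = {k. k \<ge> 1 \<and> (finite fermat_primes \<longrightarrow> k \<le> card fermat_primes)}"

definition K_max_set :: "nat set" where
  "K_max_set = {K_big q r | q r. prime q \<and> [q = 3] (mod 4) \<and> r \<ge> 1}"

definition K_min_set :: "nat set" where
  "K_min_set = {k_small q r | q r. prime q \<and> [q = 3] (mod 4) \<and> r \<ge> 1}"

definition R_set :: "nat set" where
  "R_set = {R_num r1 r2 | r1 r2. r1 \<ge> 1 \<and> r2 > 2}"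

definition F_set :: "nat set" where
  "F_set = {2 ^ a * (\<Prod>i = 1..k. nth_fermat_prime i) | a k.
     k \<in> H_set \<and> a \<ge> 1 \<and>
     (k + 1 \<in> H_set \<longrightarrow> real a \<le> log 2 (real (nth_fermat_prime (k + 1)) - 1))}"

end

theory Submission imports Defs begin

text \<open>
  For \<open>n > 0\<close> one has \<open>n = \<phi>(n) \<Prod> p/(p - 1)\<close> over the primes \<open>p\<close> dividing \<open>n\<close>, so among numbers
  with the same totient the largest is the one with the largest product. The product of the
  \<open>p - 1\<close> divides \<open>\<phi>(n)\<close>; for the families at hand the power of 2 in \<open>\<phi>(n)\<close> is small, or
  \<open>\<phi>(n)\<close> is itself a power of 2, which leaves few possible sets of odd prime factors.

  All numbers \<open>x\<close> in the three families of maxima satisfy \<open>\<phi>(x)/x \<ge> 1/4\<close>, for the Fermat products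
  because \<open>\<Prod> (1 + 2 ^ -(2 ^ l)) = 2\<close>. As \<open>\<phi>(210)/210 = 8/35 < 1/4\<close>, the first multiple of 210 beyond
  a large such \<open>x\<close> has a smaller totient, so \<open>x\<close> is not a value of \<open>N\<^sub>1\<close>.
\<close>

section \<open>Totients and prime factors\<close>

text \<open>For \<open>P\<close> the prime factors of \<open>n\<close> this is n / \<phi>(n). Taking
  an arbitrary set as argument allows the prime 2 to be split off and single primes to be
  exchanged.\<close>

definition totient_ratio :: "nat set \<Rightarrow> real" where
  "totient_ratio P = (\<Prod>p\<in>P. real p / real (p - 1))"

lemma prime_ratio_ge_1: "prime p \<Longrightarrow> real p / real (p - 1) \<ge> 1"
  using prime_ge_2_nat[of p] by (simp add: field_simps)

lemma totient_ratio_ge_1: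
  assumes "\<And>p. p \<in> P \<Longrightarrow> prime p"
  shows "totient_ratio P \<ge> 1"
  unfolding totient_ratio_def by (intro prod_ge_1 prime_ratio_ge_1 assms)

lemma totient_ratio_mono:
  assumes "finite Q" "P \<subseteq> Q" "\<And>p. p \<in> Q \<Longrightarrow> prime p"
  shows "totient_ratio P \<le> totient_ratio Q"
  unfolding totient_ratio_def using assms by (intro prod_mono2 prime_ratio_ge_1) auto

lemma totient_ratio_insert:
  "finite P \<Longrightarrow> p \<notin> P \<Longrightarrow>
    totient_ratio (insert p P) = real p / real (p - 1) * totient_ratio P"
  unfolding totient_ratio_def by simp

text \<open>Since c / (c - 1) = 1 + 1 / (c - 1), smaller primes contribute larger factors to the
  ratio.\<close>

lemma divide_pred_antimono:
  fixes c p :: nat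
  assumes "2 \<le> c" "c \<le> p"
  shows "real p / real (p - 1) \<le> real c / real (c - 1)"
  using assms by (simp add: of_nat_diff field_simps)

lemma totient_ratio_le_power:
  assumes "2 \<le> c" "\<And>p. p \<in> P \<Longrightarrow> c \<le> p" "card P \<le> k"
  shows "totient_ratio P \<le> (real c / real (c - 1)) ^ k"
proof -
  have "totient_ratio P \<le> (\<Prod>p\<in>P. real c / real (c - 1))"
    unfolding totient_ratio_def
    using divide_pred_antimono[OF assms(1)] assms(2) by (intro prod_mono) auto
  also have "\<dots> = (real c / real (c - 1)) ^ card P"
    by simp
  also have "\<dots> \<le> (real c / real (c - 1)) ^ k"
    using assms(1,3) by (intro power_increasing) (auto simp: field_simps)
  finally show ?thesis .
qed

text \<open>Each prime of the radical restores the power of p lost in p^(e - 1) (p - 1). The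
  division-free form also serves divisibility arguments.\<close>

lemma totient_times_radical:
  assumes "n > 0"
  shows "totient n * \<Prod>(prime_factors n) = n * (\<Prod>p\<in>prime_factors n. p - 1)"
proof -
  have "totient n * \<Prod>(prime_factors n) =
      (\<Prod>p\<in>prime_factors n. p ^ (multiplicity p n - 1) * (p - 1) * p)"
    unfolding totient_formula1[OF assms] by (rule prod.distrib[symmetric])
  also have "\<dots> = (\<Prod>p\<in>prime_factors n. p ^ multiplicity p n * (p - 1))"
  proof (rule prod.cong[OF refl])
    fix p assume "p \<in> prime_factors n"
    then have "multiplicity p n > 0"
      using prime_factors_multiplicity by auto
    then have "p ^ multiplicity p n = p ^ (multiplicity p n - 1) * p"
      by (metis power_minus_mult)
    then show "p ^ (multiplicity p n - 1) * (p - 1) * p = p ^ multiplicity p n * (p - 1)"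
      by simp
  qed
  also have "\<dots> = n * (\<Prod>p\<in>prime_factors n. p - 1)"
    using prime_factorization_nat[OF assms] by (simp add: prod.distrib)
  finally show ?thesis .
qed

lemma eq_totient_times_ratio:
  assumes "n > 0"
  shows "real n = real (totient n) * totient_ratio (prime_factors n)"
proof -
  have nz: "(\<Prod>p\<in>prime_factors n. p - 1) \<noteq> 0"
    by (auto dest!: prime_gt_1_nat simp: in_prime_factors_iff)
  have "real (totient n) * real (\<Prod>(prime_factors n)) =
      real n * real (\<Prod>p\<in>prime_factors n. p - 1)"
    using totient_times_radical[OF assms] by (metis of_nat_mult)
  then show ?thesis
    using nz unfolding totient_ratio_def prod_dividef by (simp add: field_simps)
qed

text \<open>The 2 is the factor 2 / (2 - 1) of the prime 2, granted whether or not \<open>n\<close>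
  is even. Maximising \<open>n\<close> is thereby reduced to its odd prime factors.\<close>

lemma le_twice_totient_times_ratio:
  assumes "n > 0"
  shows "real n \<le> 2 * real (totient n) * totient_ratio (prime_factors n - {2})"
proof -
  have "totient_ratio (prime_factors n) \<le> totient_ratio (insert 2 (prime_factors n - {2}))"
    by (rule totient_ratio_mono) (auto simp: prime_factors_dvd)
  also have "\<dots> = 2 * totient_ratio (prime_factors n - {2})"
    by (subst totient_ratio_insert) auto
  finally have "real (totient n) * totient_ratio (prime_factors n) \<le>
      real (totient n) * (2 * totient_ratio (prime_factors n - {2}))"
    by (intro mult_left_mono) auto
  then show ?thesis
    using eq_totient_times_ratio[OF assms] by (simp add: mult_ac)
qed

lemma prod_pred_prime_factors_dvd_totient:
  assumes "n > 0" "P \<subseteq> prime_factors n"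
  shows "(\<Prod>p\<in>P. p - 1) dvd totient n"
proof -
  have "(\<Prod>p\<in>P. p - 1) dvd (\<Prod>p\<in>prime_factors n. p - 1)"
    by (rule prod_dvd_prod_subset) (use assms in auto)
  also have "\<dots> dvd (\<Prod>p\<in>prime_factors n. p ^ (multiplicity p n - 1) * (p - 1))"
    by (rule prod_dvd_prod) auto
  finally show ?thesis
    using totient_formula1[OF assms(1)] by simp
qed

lemma prod_pred_odd_prime_factors:
  fixes n :: nat
  shows "(\<Prod>p\<in>prime_factors n - {2}. p - 1) = (\<Prod>p\<in>prime_factors n. p - 1)"
  by (rule prod.mono_neutral_left) auto

text \<open>In \<phi>(n) rad(n) = n \<Prod> (p - 1), a divisor of \<phi>(n) coprime to
  \<open>n\<close> must come from the factors p - 1 alone; the prime 2 contributes only 1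
  there.\<close>

lemma coprime_dvd_totient_imp:
  assumes "n > 0" "d dvd totient n" "coprime d n"
  shows "d dvd (\<Prod>p\<in>prime_factors n - {2}. p - 1)"
proof -
  have "d dvd n * (\<Prod>p\<in>prime_factors n. p - 1)"
    using totient_times_radical[OF assms(1)] assms(2) by (metis dvd_mult2)
  then show ?thesis
    using assms(3) by (simp only: coprime_dvd_mult_right_iff prod_pred_odd_prime_factors)
qed

lemma two_power_card_dvd_prod_pred:
  assumes "\<And>p. p \<in> P \<Longrightarrow> odd (p :: nat)"
  shows "2 ^ card P dvd (\<Prod>p\<in>P. p - 1)"
proof -
  have "(\<Prod>p\<in>P. 2) dvd (\<Prod>p\<in>P. p - 1)"
    by (rule prod_dvd_prod) (use assms in auto)
  then show ?thesis by simp
qed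

lemma odd_prime_factors:
  assumes "p \<in> prime_factors n - {2 :: nat}"
  shows "prime p" "odd p" "3 \<le> p" "p dvd n"
proof -
  show p: "prime p" "p dvd n" using assms by auto
  have "p \<noteq> 2" using assms by auto
  with p(1) show "3 \<le> p" using prime_ge_2_nat[of p] by linarith
  then show "odd p" using p by (intro prime_odd_nat) auto
qed

text \<open>Each odd prime factor p puts the even number p - 1 into \<phi>(n), so the power of 2 in
  \<phi>(n) limits how many there are.\<close>

lemma card_odd_prime_factors_le:
  assumes "n > 0" "\<not> 2 ^ Suc k dvd totient n"
  shows "card (prime_factors n - {2}) \<le> k"
proof (rule ccontr)
  assume "\<not> ?thesis"
  then have "2 ^ Suc k dvd (2 :: nat) ^ card (prime_factors n - {2})"
    by (intro le_imp_power_dvd) simp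
  also have "\<dots> dvd (\<Prod>p\<in>prime_factors n - {2}. p - 1)"
    by (rule two_power_card_dvd_prod_pred) (rule odd_prime_factors)
  also have "\<dots> dvd totient n"
    by (rule prod_pred_prime_factors_dvd_totient) (use assms in auto)
  finally show False using assms(2) by simp
qed

section \<open>Extremal values\<close>

text \<open>A prime factor p of x has p - 1 dividing \<phi>(x), so p \<le> m + 1 and rad(x) divides
  (m + 1)!. Then x \<le> x \<Prod> (p - 1) = \<phi>(x) rad(x) is bounded.\<close>

lemma finite_totient_le: "finite {x. x > 0 \<and> totient x \<le> m}"
proof (rule finite_subset)
  show "{x. x > 0 \<and> totient x \<le> m} \<subseteq> {..m * fact (Suc m)}"
  proof
    fix x assume "x \<in> {x. x > 0 \<and> totient x \<le> m}"
    then have x: "x > 0" "totient x \<le> m" by auto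
    have "p \<le> Suc m" if "p \<in> prime_factors x" for p
    proof -
      have "p - 1 dvd totient x"
        using prod_pred_prime_factors_dvd_totient[of x "{p}"] that x by simp
      then have "p - 1 \<le> totient x"
        by (rule dvd_imp_le) (use x in simp)
      then show ?thesis using x by simp
    qed
    then have "prime_factors x \<subseteq> {1..Suc m}"
      by (auto simp: in_prime_factors_iff prime_gt_0_nat Suc_le_eq)
    then have "\<Prod>(prime_factors x) dvd \<Prod>{1..Suc m}"
      by (intro prod_dvd_prod_subset) auto
    then have "\<Prod>(prime_factors x) dvd fact (Suc m)"
      by (simp only: fact_prod of_nat_id)
    then have rad: "\<Prod>(prime_factors x) \<le> fact (Suc m)"
      by (rule dvd_imp_le) simp
    have "(\<Prod>p\<in>prime_factors x. p - 1) \<ge> 1"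
      by (intro prod_ge_1) (auto dest!: prime_gt_1_nat simp: in_prime_factors_iff)
    then have "x \<le> x * (\<Prod>p\<in>prime_factors x. p - 1)"
      by simp
    also have "\<dots> = totient x * \<Prod>(prime_factors x)"
      using totient_times_radical[OF x(1)] by simp
    also have "\<dots> \<le> m * fact (Suc m)"
      using x rad by (intro mult_le_mono) auto
    finally show "x \<in> {..m * fact (Suc m)}" by simp
  qed
qed simp

lemma finite_totient_preimage: "finite (totient_preimage m)"
  by (rule finite_subset[OF _ finite_totient_le[of m]]) (auto simp: totient_preimage_def)

lemma N2_setI:
  assumes "x > 0" "\<And>y. y > 0 \<Longrightarrow> totient y = totient x \<Longrightarrow> y \<le> x"
  shows "x \<in> N2_set"
proof -
  have "N2 (totient x) = x"
    unfolding N2_def using assms finite_totient_preimage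
    by (intro Max_eqI) (auto simp: totient_preimage_def)
  then show ?thesis
    unfolding N2_set_def totient_values_def using assms(1) by force
qed

lemma N3_setI:
  assumes "x > 0" "\<And>y. y > 0 \<Longrightarrow> totient y = totient x \<Longrightarrow> x \<le> y"
  shows "x \<in> N3_set"
proof -
  have "N3 (totient x) = x"
    unfolding N3_def using assms finite_totient_preimage
    by (intro Min_eqI) (auto simp: totient_preimage_def)
  then show ?thesis
    unfolding N3_set_def totient_values_def using assms(1) by force
qed

text \<open>In the applications \<open>x\<close> is even and \<open>c\<close> is the ratio over its
  odd prime factors, so \<open>x\<close> attains the upper bound that holds for every competitor
  \<open>y\<close>.\<close>

lemma N2_setI_ratio:
  assumes "x > 0" "real x = 2 * real (totient x) * c"
    and "\<And>y. y > 0 \<Longrightarrow> totient y = totient x \<Longrightarrow> totient_ratio (prime_factors y - {2}) \<le> c"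
  shows "x \<in> N2_set"
proof (rule N2_setI[OF assms(1)])
  fix y :: nat assume y: "y > 0" "totient y = totient x"
  have "real y \<le> 2 * real (totient y) * totient_ratio (prime_factors y - {2})"
    by (rule le_twice_totient_times_ratio[OF y(1)])
  also have "\<dots> \<le> 2 * real (totient y) * c"
    using assms(3)[OF y] by (intro mult_left_mono) auto
  finally show "y \<le> x" using y assms(2) by simp
qed

text \<open>\<open>x\<close> is the largest number whose totient stays within some threshold, so the
  totient of any larger \<open>y\<close> exceeds that threshold.\<close>

lemma N1_set_totient_less:
  assumes "x \<in> N1_set" "x < y"
  shows "totient x < totient y"
proof -
  obtain n where n: "n > 0" "x = N1 (totient n)"
    using assms(1) unfolding N1_set_def totient_values_def by auto
  let ?S = "{x. x > 0 \<and> totient x \<le> totient n}"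
  have "n \<in> ?S" using n by auto
  then have "x \<in> ?S"
    using Max_in[of ?S] finite_totient_le[of "totient n"] n(2) unfolding N1_def by blast
  moreover have "y \<notin> ?S"
    using Max_ge[of ?S y] finite_totient_le[of "totient n"] n(2) assms(2) unfolding N1_def
    by (meson not_le)
  ultimately show ?thesis using assms(2) by auto
qed

section \<open>Finiteness of the intersections with the values of \<open>N1\<close>\<close>

lemma totient_210: "totient 210 = 48"
proof -
  have p: "prime (3::nat)" "prime (5::nat)" "prime (7::nat)" by simp_all
  then have "coprime (3::nat) 35" "coprime (5::nat) 7"
    by (auto intro: prime_imp_coprime)
  then have "totient (3 * 35) = totient 3 * totient 35" "totient (5 * 7) = totient 5 * totient 7"
    by (simp_all only: totient_mult_coprime)
  moreover have "totient 3 = 2" "totient 5 = 4" "totient 7 = 6"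
    using p by (simp_all add: totient_prime)
  moreover have "totient (2 * 105) = totient 105"
    by (subst totient_double) simp
  ultimately show ?thesis by simp
qed

text \<open>The prime factors of \<open>n\<close> persist in \<open>m * n\<close>, so passing to a
  multiple cannot lower the ratio n / \<phi>(n).\<close>

lemma totient_mult_le: "totient (m * n) \<le> m * totient n"
proof (cases "m = 0 \<or> n = 0")
  case False
  have "totient_ratio (prime_factors n) \<le> totient_ratio (prime_factors (m * n))"
    using False by (intro totient_ratio_mono) (auto simp: prime_factors_dvd)
  then have "real (totient (m * n)) * totient_ratio (prime_factors n) \<le> real (m * n)"
    using False eq_totient_times_ratio[of "m * n"] by (simp add: mult_left_mono)
  also have "\<dots> = real (m * totient n) * totient_ratio (prime_factors n)"
    using False eq_totient_times_ratio[of n] by simp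
  finally have "real (totient (m * n)) \<le> real (m * totient n)"
    by (rule mult_right_le_imp_le)
      (auto intro: less_le_trans[OF zero_less_one totient_ratio_ge_1])
  then show ?thesis by linarith
qed auto

lemma N1_set_bounded:
  assumes "x \<in> N1_set" "x \<le> 4 * totient x"
  shows "x \<le> 2240"
proof -
  define d where "d = x div 210"
  have d: "x < (d + 1) * 210" "d * 210 \<le> x"
    using dividend_less_div_times[of 210 x] unfolding d_def by simp_all
  from d(1) have "totient x < totient ((d + 1) * 210)"
    by (rule N1_set_totient_less[OF assms(1)])
  also have "\<dots> \<le> (d + 1) * 48"
    using totient_mult_le[of "d + 1" 210] by (simp add: totient_210)
  finally have "totient x < 48 * d + 48" by simp
  \<comment> \<open>From x \<le> 4 \<phi>(x) < 192 d + 192 and d \<le> x / 210 follows (18 / 210) x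
    < 192, that is, x < 2240.\<close>
  then show ?thesis using assms(2) d(2) by simp
qed

lemma finite_inter_N1_set:
  assumes "\<And>x. x \<in> A \<Longrightarrow> x \<le> 4 * totient x"
  shows "finite (A \<inter> N1_set)"
  by (rule finite_subset[of _ "{..2240}"]) (use assms N1_set_bounded in auto)

section \<open>Prime powers with base 3 modulo 4\<close>

lemma mod_4_eq_3_prime:
  fixes q :: nat
  assumes "prime q" "[q = 3] (mod 4)"
  shows "q \<ge> 3" "odd q" "\<not> 4 dvd q - 1"
proof -
  have m: "q mod 4 = 3" using assms(2) by (simp add: cong_def)
  then show "q \<ge> 3" by presburger
  from m show "odd q" by presburger
  from m show "\<not> 4 dvd q - 1" by presburger
qed

text \<open>\<open>q\<close> is odd and q - 1 is 2 modulo 4, so the product contains exactly one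
  factor 2.\<close>

lemma not_four_dvd_K_totient:
  fixes q :: nat
  assumes "prime q" "[q = 3] (mod 4)"
  shows "\<not> 4 dvd q ^ r * (q - 1)"
proof -
  have "coprime 4 (q ^ r)"
    using mod_4_eq_3_prime(2)[OF assms] by (intro coprime_power_right_iff[THEN iffD2] disjI1)
      (metis coprime_left_2_iff_odd coprime_power_left_iff num_double power2_eq_square
        numeral_times_numeral)
  then show ?thesis
    using mod_4_eq_3_prime(3)[OF assms] by (simp add: coprime_dvd_mult_right_iff)
qed

lemma totient_K_big:
  assumes "prime q" "odd q"
  shows "totient (K_big q r) = q ^ r * (q - 1)"
  using assms totient_prime_power_Suc[of q r] by (simp add: K_big_def totient_double)

text \<open>Because \<open>\<phi>(y)\<close> is not divisible by \<open>4\<close>, \<open>y\<close> has at most one odd prime factor.\<close>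

lemma odd_prime_factors_K:
  assumes "prime q" "[q = 3] (mod 4)" "y > 0" "totient y = q ^ r * (q - 1)"
  obtains "prime_factors y - {2} = {}"
  | p where "prime_factors y - {2} = {p}"
proof -
  have "card (prime_factors y - {2}) \<le> 1"
    using card_odd_prime_factors_le[of y 1] not_four_dvd_K_totient[OF assms(1,2)] assms(3,4)
    by (simp del: card_Diff_insert)
  moreover have "finite (prime_factors y - {2})" by simp
  ultimately consider "prime_factors y - {2} = {}" | "card (prime_factors y - {2}) = 1"
    by (metis card_0_eq le_SucE le_zero_eq One_nat_def)
  then show ?thesis
    by cases (rule that(1), assumption, erule card_1_singletonE, rule that(2))
qed

text \<open>A competitor has at most one odd prime factor p, so p \<ge> q suffices. If p < q, then q
  divides \<phi>(y) (because r \<ge> 1) but not y, hence divides p - 1, which is too small.\<close>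

lemma K_big_in_N2_set:
  assumes q: "prime q" "[q = 3] (mod 4)" and r: "r \<ge> 1"
  shows "K_big q r \<in> N2_set"
proof (rule N2_setI_ratio[where c = "real q / real (q - 1)"])
  note q3 = mod_4_eq_3_prime[OF q]
  note tK = totient_K_big[OF q(1) q3(2)]
  show "K_big q r > 0" using q3 by (simp add: K_big_def)
  show "real (K_big q r) = 2 * real (totient (K_big q r)) * (real q / real (q - 1))"
    using q3 unfolding tK by (simp add: K_big_def)
  fix y :: nat assume y: "y > 0" "totient y = totient (K_big q r)"
  have ty: "totient y = q ^ r * (q - 1)" using y tK by simp
  from q y(1) ty show "totient_ratio (prime_factors y - {2}) \<le> real q / real (q - 1)"
  proof (cases rule: odd_prime_factors_K)
    case 1
    show ?thesis
      unfolding 1 using prime_ratio_ge_1[OF q(1)] by (simp add: totient_ratio_def)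
  next
    case (2 p)
    have p: "prime p" "p dvd y" "3 \<le> p" using odd_prime_factors[of p y] 2 by auto
    have "q \<le> p"
    proof (rule ccontr)
      assume "\<not> q \<le> p"
      have "\<not> q dvd y"
      proof
        assume "q dvd y"
        then have "q \<in> prime_factors y - {2}"
          using q q3 y by (auto simp: prime_factors_dvd)
        then show False using 2 \<open>\<not> q \<le> p\<close> by auto
      qed
      then have "coprime q y" using q(1) by (intro prime_imp_coprime)
      moreover have "q dvd totient y" using ty r by (simp add: dvd_power)
      ultimately have "q dvd (\<Prod>p\<in>prime_factors y - {2}. p - 1)"
        by (intro coprime_dvd_totient_imp y(1))
      then have "q dvd p - 1" unfolding 2 by simp
      then have "q \<le> p - 1" using p by (intro dvd_imp_le) auto
      then show False using \<open>\<not> q \<le> p\<close> by simp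
    qed
    then show ?thesis
      unfolding 2 using divide_pred_antimono[of q p] q3 by (simp add: totient_ratio_def)
  qed
qed

section \<open>Smallest preimages for the same totients\<close>

lemma totient_k_small:
  assumes "prime q"
  shows "totient (k_small q r) = q ^ r * (q - 1)"
  using assms totient_prime_power_Suc[OF assms, of r] by (auto simp: k_small_def totient_prime)

text \<open>The general bound y \<ge> \<phi>(y) + 1 settles the case that m + 1 is prime, with m =
  \<phi>(y). Otherwise it suffices that the ratio of y is at least q / (q - 1), as m q / (q - 1) =
  q^(r + 1).\<close>

lemma k_small_in_N3_set:
  assumes q: "prime q" "[q = 3] (mod 4)" and r: "r \<ge> 1"
  shows "k_small q r \<in> N3_set"
proof (rule N3_setI)
  note q3 = mod_4_eq_3_prime[OF q]
  let ?m = "q ^ r * (q - 1)"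
  show "k_small q r > 0" using q3 by (auto simp: k_small_def)
  fix y :: nat assume y: "y > 0" "totient y = totient (k_small q r)"
  have ty: "totient y = ?m" using y totient_k_small[OF q(1)] by simp
  have "q ^ 1 \<le> q ^ r" using q3 r by (intro power_increasing) auto
  then have "3 * 2 \<le> ?m" using q3 by (intro mult_le_mono) auto
  then have "totient y > 1" using ty by simp
  then have "y > 1" using totient_le[of y] by simp
  then have lower: "?m + 1 \<le> y" using totient_less[of y] ty by simp
  show "k_small q r \<le> y"
  proof (cases "prime (?m + 1)")
    case True
    then show ?thesis using lower by (simp add: k_small_def)
  next
    case False
    have "real q / real (q - 1) \<le> totient_ratio (prime_factors y)"
      using q y(1) ty
    proof (cases rule: odd_prime_factors_K)
      case 1
      then have "prime_factors y = {2}"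
        using \<open>y > 1\<close> prime_factorization_empty_iff[of y] by auto
      then show ?thesis
        \<comment> \<open>Here y is a power of 2 with ratio 2, the largest value that x / (x - 1)
          takes for x \<ge> 2.\<close>
        using divide_pred_antimono[of 2 q] q3 by (simp add: totient_ratio_def)
    next
      case (2 p)
      have p: "prime p" "p dvd y" "3 \<le> p" "odd p" using odd_prime_factors[of p y] 2 by auto
      \<comment> \<open>A prime p > q does not divide m, so it divides y only once: y = p u and m =
        (p - 1) \<phi>(u). As 4 does not divide m, \<phi>(u) is odd, so u \<le> 2 and p = m + 1,
        which is not prime in this case.\<close>
      have "p \<le> q"
      proof (rule ccontr)
        assume "\<not> p \<le> q"
        have "\<not> p dvd ?m"
        proof
          assume "p dvd ?m"
          then consider "p dvd q ^ r" | "p dvd q - 1" using p(1) prime_dvd_mult_iff by blast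
          then show False
          proof cases
            case 1
            then have "p dvd q" using p(1) prime_dvd_power by blast
            then show False using \<open>\<not> p \<le> q\<close> q3 dvd_imp_le[of p q] by simp
          next
            case 2
            then show False using \<open>\<not> p \<le> q\<close> q3 dvd_imp_le[of p "q - 1"] by simp
          qed
        qed
        obtain u where u: "y = p * u" using p(2) by auto
        have "\<not> p dvd u"
        proof
          assume "p dvd u"
          then have "p * p dvd y" using u by simp
          then have "totient (p * p) dvd totient y" by (rule totient_dvd)
          moreover have "p dvd totient (p * p)"
            using totient_prime_power_Suc[OF p(1), of 1] by simp
          ultimately show False using \<open>\<not> p dvd ?m\<close> ty dvd_trans by metis
        qed
        then have "coprime p u" using p(1) by (intro prime_imp_coprime)
        then have m: "?m = (p - 1) * totient u"
          using ty u p(1) by (simp add: totient_mult_coprime totient_prime)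
        have "odd (totient u)"
        proof
          assume "even (totient u)"
          then have "2 * 2 dvd (p - 1) * totient u" using p(4) by (intro mult_dvd_mono) auto
          then show False using m not_four_dvd_K_totient[OF q, of r] by simp
        qed
        then have "u \<le> 2" using totient_even[of u] by force
        moreover have "u > 0" using u y by auto
        ultimately have "u = 1 \<or> u = 2" by auto
        then have "totient u = 1" by auto
        then have "?m + 1 = p" using m p by simp
        then show False using False p(1) by simp
      qed
      then have "real q / real (q - 1) \<le> totient_ratio {p}"
        using divide_pred_antimono[of p q] p by (simp add: totient_ratio_def)
      also have "\<dots> \<le> totient_ratio (prime_factors y)"
        using 2 by (intro totient_ratio_mono) auto
      finally show ?thesis .
    qed
    then have "real (totient y) * (real q / real (q - 1)) \<le> real y"
      by (subst eq_totient_times_ratio[OF y(1)]) (intro mult_left_mono, auto)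
    then have "real (q ^ (r + 1)) \<le> real y"
      using q3 unfolding ty by (simp add: mult_ac)
    then have "q ^ (r + 1) \<le> y" by linarith
    then show ?thesis using False by (simp add: k_small_def)
  qed
qed

text \<open>Here \<open>7\<close> divides \<open>2 * 3 ^ (6 j + 7) + 1\<close>, because \<open>3\<close> has order \<open>6\<close> modulo \<open>7\<close>.\<close>

lemma k_small_3_eq_power: "k_small 3 (6 * j + 7) = 3 ^ (6 * j + 8)"
proof -
  have "[(3::nat) ^ 6 = 1] (mod 7)" by (simp add: cong_def)
  then have "[((3::nat) ^ 6) ^ (j + 1) = 1 ^ (j + 1)] (mod 7)" by (rule cong_pow)
  then have "[(3::nat) ^ (6 * j + 6) = 1] (mod 7)"
    by (simp only: power_mult[symmetric] power_one distrib_left mult_1_right)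
  then have "[6 * (3::nat) ^ (6 * j + 6) + 1 = 6 * 1 + 1] (mod 7)"
    by (intro cong_add cong_mult) auto
  moreover have "(3::nat) ^ (6 * j + 7) * (3 - 1) + 1 = 6 * (3::nat) ^ (6 * j + 6) + 1"
    by (simp add: power_add)
  ultimately have "7 dvd (3::nat) ^ (6 * j + 7) * (3 - 1) + 1"
    by (simp add: cong_def dvd_eq_mod_eq_0)
  moreover have "(7::nat) < 3 ^ (6 * j + 7) * (3 - 1) + 1"
  proof -
    have "(3::nat) ^ 7 \<le> 3 ^ (6 * j + 7)" by (intro power_increasing) auto
    then show ?thesis by simp
  qed
  ultimately have "\<not> prime ((3::nat) ^ (6 * j + 7) * (3 - 1) + 1)"
    by (metis prime_nat_iff nat_neq_iff numeral_eq_one_iff semiring_norm(86))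
  then show ?thesis by (simp add: k_small_def)
qed

text \<open>The single prime q = 3 is enough: the exponents r = 6 j + 7 yield proper powers of
  3.\<close>

lemma infinite_composite_K_min: "infinite {n \<in> K_min_set. n > 1 \<and> \<not> prime n}"
proof -
  have "inj (\<lambda>j. (3::nat) ^ (6 * j + 8))"
    by (rule injI) simp
  then have "infinite (range (\<lambda>j. (3::nat) ^ (6 * j + 8)))"
    by (rule range_inj_infinite)
  moreover have "range (\<lambda>j. (3::nat) ^ (6 * j + 8)) \<subseteq> {n \<in> K_min_set. n > 1 \<and> \<not> prime n}"
  proof
    fix n :: nat assume "n \<in> range (\<lambda>j. (3::nat) ^ (6 * j + 8))"
    then obtain j where j: "n = 3 ^ (6 * j + 8)" by auto
    then have "n = k_small 3 (6 * j + 7)" by (simp only: k_small_3_eq_power)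
    moreover have "prime (3::nat)" "[3 = 3 :: nat] (mod 4)" "(6 * j + 7 :: nat) \<ge> 1" by auto
    ultimately have "n \<in> K_min_set" unfolding K_min_set_def by blast
    moreover have "n > 1" unfolding j by (rule one_less_power) auto
    moreover have "\<not> prime n" unfolding j by (subst prime_power_iff) auto
    ultimately show "n \<in> {n \<in> K_min_set. n > 1 \<and> \<not> prime n}" by simp
  qed
  ultimately show ?thesis by (rule infinite_super[rotated])
qed

section \<open>Infinitude and ratio bound for \<open>K_max_set\<close>\<close>

lemma infinite_K_max_set: "infinite K_max_set"
proof -
  have "inj (\<lambda>r. K_big 3 (r + 1))"
    by (rule injI) (simp add: K_big_def)
  then have "infinite (range (\<lambda>r. K_big 3 (r + 1)))"
    by (rule range_inj_infinite)
  moreover have "range (\<lambda>r. K_big 3 (r + 1)) \<subseteq> K_max_set"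
    unfolding K_max_set_def by (rule image_subsetI) (force intro: cong_refl)
  ultimately show ?thesis by (rule infinite_super[rotated])
qed

lemma K_max_set_le_4_totient:
  assumes "x \<in> K_max_set"
  shows "x \<le> 4 * totient x"
proof -
  obtain q r where x: "x = K_big q r" and q: "prime q" "[q = 3] (mod 4)"
    using assms unfolding K_max_set_def by auto
  note q3 = mod_4_eq_3_prime[OF q]
  have "x = q ^ r * (2 * q)" unfolding x K_big_def by simp
  also have "\<dots> \<le> q ^ r * (4 * (q - 1))" using q3 by (intro mult_left_mono) auto
  finally show ?thesis unfolding x totient_K_big[OF q(1) q3(2)] by simp
qed

section \<open>Numbers composed of 2, 3 and 5\<close>

text \<open>The 8 is (3 - 1) (5 - 1); the successors make both exponents positive, so that 3 and 5
  really divide the number.\<close>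

lemma totient_R_num: "totient (R_num (Suc a) (Suc b)) = 8 * 3 ^ a * 5 ^ b"
proof -
  have "coprime (3::nat) 5" by (rule primes_coprime) auto
  then have "coprime ((3::nat) ^ Suc a) (5 ^ Suc b)"
    by (simp only: coprime_power_left_iff coprime_power_right_iff) simp
  then have "totient (3 ^ Suc a * 5 ^ Suc b) = totient (3 ^ Suc a) * totient (5 ^ Suc b)"
    by (rule totient_mult_coprime)
  also have "\<dots> = 8 * 3 ^ a * 5 ^ b"
    using totient_prime_power_Suc[of 3 a] totient_prime_power_Suc[of 5 b] by simp
  finally have "totient (3 ^ Suc a * 5 ^ Suc b) = 8 * 3 ^ a * 5 ^ b" .
  moreover have "totient (2 * (3 ^ Suc a * 5 ^ Suc b)) = totient (3 ^ Suc a * 5 ^ Suc b)"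
    by (subst totient_double) simp
  ultimately show ?thesis by (simp add: R_num_def mult.assoc)
qed

lemma not_16_dvd_R_totient: "\<not> (16::nat) dvd 8 * 3 ^ a * 5 ^ b"
proof
  assume "(16::nat) dvd 8 * 3 ^ a * 5 ^ b"
  then have "8 * 2 dvd 8 * ((3::nat) ^ a * 5 ^ b)" by (simp add: mult.assoc)
  then have "2 dvd (3::nat) ^ a * 5 ^ b" by (subst (asm) nat_mult_dvd_cancel1) simp_all
  then show False by simp
qed

text \<open>The bound 15/8 = 3/2 * 5/4 is the ratio of {3, 5}. As 16 does not divide \<phi>(y),
  there are at most three odd primes, and the cases are split by which of 3, 5, 7 occur.\<close>

lemma totient_ratio_le_R:
  assumes y: "y > 0" and ty: "totient y = 8 * 3 ^ a * 5 ^ b" and b: "b \<ge> 2"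
  shows "totient_ratio (prime_factors y - {2}) \<le> 15 / 8"
proof -
  define P where "P = prime_factors y - {2}"
  have fin: "finite P" unfolding P_def by simp
  have P: "prime p" "odd p" "3 \<le> p" if "p \<in> P" for p
    using odd_prime_factors[of p y] that unfolding P_def by auto
  have P_ge_7: "p \<ge> 7" if "p \<in> P" "p \<noteq> 3" "p \<noteq> 5" for p
    using P(2,3)[OF that(1)] that(2,3) by presburger
  have P_ge_11: "p \<ge> 11" if "p \<in> P" "p \<noteq> 3" "p \<noteq> 5" "p \<noteq> 7" for p
  proof -
    have "p \<noteq> 9" using P(1)[OF that(1)] by auto
    then show ?thesis using P(2,3)[OF that(1)] that(2-) by presburger
  qed
  have sub: "\<not> 16 dvd (\<Prod>p\<in>Q. p - 1)" if "Q \<subseteq> P" for Q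
    using prod_pred_prime_factors_dvd_totient[OF y, of Q] not_16_dvd_R_totient[of a b] that ty
    unfolding P_def by (metis Diff_subset dvd_trans subset_trans)
  have card: "card P \<le> 3"
    using card_odd_prime_factors_le[OF y, of 3] not_16_dvd_R_totient[of a b] ty
    unfolding P_def by (simp del: card_Diff_insert)
  have remove: "totient_ratio P = real q / real (q - 1) * totient_ratio (P - {q})"
    "card (P - {q}) = card P - 1" if "q \<in> P" for q
    using totient_ratio_insert[of "P - {q}" q] fin that by (auto simp: insert_absorb)
  consider "3 \<notin> P" "5 \<notin> P" | "3 \<notin> P" "5 \<in> P" | "3 \<in> P" "5 \<in> P"
    | "3 \<in> P" "5 \<notin> P" "7 \<notin> P" | "3 \<in> P" "5 \<notin> P" "7 \<in> P"
    by blast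
  then have "totient_ratio P \<le> 15 / 8"
  proof cases
    case 1
    \<comment> \<open>Numerically (7/6)^3 = 343/216 < 15/8.\<close>
    have "totient_ratio P \<le> (real 7 / real (7 - 1)) ^ 3"
      by (rule totient_ratio_le_power) (use 1 P_ge_7 card in auto)
    then show ?thesis by (simp add: power3_eq_cube)
  next
    case 2
    \<comment> \<open>Together with the factor of 5 this gives 5/4 * (7/6)^2 < 15/8.\<close>
    have "totient_ratio (P - {5}) \<le> (real 7 / real (7 - 1)) ^ 2"
      by (rule totient_ratio_le_power) (use 2 P_ge_7 card remove(2)[of 5] in auto)
    then show ?thesis using remove(1)[OF 2(2)] by (simp add: power2_eq_square)
  next
    case 3
    have "P = {3, 5}"
    proof (rule ccontr)
      assume "P \<noteq> {3, 5}"
      then obtain p where p: "p \<in> P" "p \<noteq> 3" "p \<noteq> 5" using 3 by auto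
      \<comment> \<open>The primes 3 and 5 already use up the factor 8, so a third odd prime would
        make 16 divide \<phi>(y).\<close>
      have "2 dvd p - 1" using P(2)[OF p(1)] by simp
      then have "8 * 2 dvd 8 * (p - 1)" by (rule mult_dvd_mono[OF dvd_refl])
      moreover have "(\<Prod>p\<in>{3, 5, p}. p - 1) = 8 * (p - 1)" using p by simp
      ultimately show False using sub[of "{3, 5, p}"] 3 p by simp
    qed
    then show ?thesis by (simp add: totient_ratio_def)
  next
    case 4
    \<comment> \<open>Without 5 and 7 the next prime is 11, and 3/2 * (11/10)^2 = 1.815 <
      15/8.\<close>
    have "totient_ratio (P - {3}) \<le> (real 11 / real (11 - 1)) ^ 2"
      by (rule totient_ratio_le_power) (use 4 P_ge_11 card remove(2)[of 3] in auto)
    then show ?thesis using remove(1)[OF 4(1)] by (simp add: power2_eq_square)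
  next
    case 5
    show ?thesis
    proof (cases "P = {3, 7}")
      case True
      then show ?thesis by (simp add: totient_ratio_def)
    next
      case False
      \<comment> \<open>Since 3/2 * 7/6 = 7/4, the third prime must satisfy p / (p - 1) \<le> 15/14.
        The dangerous values are 11 and 13, which are excluded arithmetically.\<close>
      then obtain p where p: "p \<in> P" "p \<noteq> 3" "p \<noteq> 7" using 5 by auto
      have "{3, 7, p} \<subseteq> P" using 5 p by auto
      moreover have "card P \<le> card {3, 7, p}" using card p by simp
      ultimately have Peq: "P = {3, 7, p}" using fin by (metis card_seteq)
      have "\<not> 4 dvd p - 1"
      proof
        assume "4 dvd p - 1"
        then have "4 * 4 dvd 12 * (p - 1)" by (intro mult_dvd_mono) auto
        then show False using sub[of P] p unfolding Peq by simp
      qed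
      \<comment> \<open>The product (3 - 1) (7 - 1) (11 - 1) = 120 has a single factor 5, whereas 25
        divides \<phi>(y) and 5 does not divide y. This is where \<open>b \<ge> 2\<close>, hence r2
        > 2, enters.\<close>
      have "p \<noteq> 11"
      proof
        assume "p = 11"
        have "\<not> 5 dvd y" using 5(2) y unfolding P_def by (auto simp: prime_factors_dvd)
        then have "coprime 5 y" by (intro prime_imp_coprime) auto
        then have "coprime (5 ^ 2) y" by (simp only: coprime_power_left_iff) simp
        moreover have "5 ^ 2 dvd totient y"
          unfolding ty using b by (intro dvd_mult le_imp_power_dvd)
        ultimately have "5 ^ 2 dvd (\<Prod>p\<in>P. p - 1)"
          unfolding P_def by (intro coprime_dvd_totient_imp y)
        then show False unfolding Peq \<open>p = 11\<close> by simp
      qed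
      moreover have "p \<noteq> 15" using P(1)[OF p(1)] by auto
      moreover have "p \<noteq> 13" "p \<noteq> 17" using \<open>\<not> 4 dvd p - 1\<close> by auto
      moreover have "p \<noteq> 5" using 5 p by auto
      ultimately have "p \<ge> 19" using P_ge_11[OF p(1)] P(2)[OF p(1)] p by presburger
      then have "real p / real (p - 1) \<le> 19 / 18"
        using divide_pred_antimono[of 19 p] by simp
      then show ?thesis unfolding Peq totient_ratio_def using p by simp
    qed
  qed
  then show ?thesis unfolding P_def .
qed

lemma real_R_num:
  assumes "r1 \<ge> 1" "r2 \<ge> 1"
  shows "real (R_num r1 r2) = 2 * real (totient (R_num r1 r2)) * (15 / 8)"
proof -
  obtain a b where "r1 = Suc a" "r2 = Suc b" using assms by (metis Suc_le_D One_nat_def)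
  then show ?thesis using totient_R_num[of a b] by (simp add: R_num_def)
qed

lemma R_set_subset_N2_set: "R_set \<subseteq> N2_set"
proof
  fix x assume "x \<in> R_set"
  then obtain r1 r2 where x: "x = R_num r1 r2" and r: "r1 \<ge> 1" "r2 > 2"
    unfolding R_set_def by auto
  then obtain a b where ab: "r1 = Suc a" "r2 = Suc b" "b \<ge> 2"
    by (cases r1; cases r2) auto
  show "x \<in> N2_set"
  proof (rule N2_setI_ratio[where c = "15 / 8"])
    show "x > 0" unfolding x R_num_def by simp
    show "real x = 2 * real (totient x) * (15 / 8)"
      unfolding x using r by (intro real_R_num) auto
    show "totient_ratio (prime_factors y - {2}) \<le> 15 / 8"
      if "y > 0" "totient y = totient x" for y
      using that(2) unfolding x ab(1,2) totient_R_num
      by (rule totient_ratio_le_R[OF that(1) _ ab(3)])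
  qed
qed

lemma R_set_le_4_totient:
  assumes "x \<in> R_set"
  shows "x \<le> 4 * totient x"
proof -
  obtain r1 r2 where "x = R_num r1 r2" "r1 \<ge> 1" "r2 > 2"
    using assms unfolding R_set_def by auto
  then have "real x = 2 * real (totient x) * (15 / 8)" using real_R_num[of r1 r2] by simp
  then show ?thesis by linarith
qed

lemma infinite_R_set: "infinite R_set"
proof -
  have "inj (\<lambda>r. R_num 1 (r + 3))"
    by (rule injI) (simp add: R_num_def)
  then have "infinite (range (\<lambda>r. R_num 1 (r + 3)))"
    by (rule range_inj_infinite)
  moreover have "range (\<lambda>r. R_num 1 (r + 3)) \<subseteq> R_set"
    unfolding R_set_def by (rule image_subsetI) force
  ultimately show ?thesis by (rule infinite_super[rotated])
qed

section \<open>Products of Fermat primes\<close>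

text \<open>Modulo x + 1 one has x = -1. The induction multiplies by x^2 = (x - 1) (x + 1) + 1,
  which avoids negative numbers.\<close>

lemma Suc_dvd_odd_power_plus_1:
  assumes "x \<ge> (1 :: nat)"
  shows "x + 1 dvd x ^ (2 * j + 1) + 1"
proof (induction j)
  case (Suc j)
  have "x * x = (x - 1) * (x + 1) + 1"
    using assms by (cases x) auto
  then have "x * x * (x ^ (2 * j + 1) + 1) = x ^ (2 * Suc j + 1) + 1 + (x - 1) * (x + 1)"
    by (simp add: algebra_simps)
  moreover have "x + 1 dvd x * x * (x ^ (2 * j + 1) + 1)"
    using Suc by (rule dvd_mult)
  ultimately show ?case
    by (metis dvd_add_left_iff dvd_triv_right)
qed simp

text \<open>Write k = 2^v m with m odd. Then 2^(2^v) + 1 divides 2^k + 1 and, exceeding 1, equals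
  this prime.\<close>

lemma prime_two_power_plus_1_imp:
  assumes "prime (2 ^ k + 1 :: nat)" "k > 0"
  shows "2 ^ k + 1 \<in> fermat_primes"
proof -
  obtain m where m: "k = 2 ^ multiplicity 2 k * m" "odd m"
    using multiplicity_decompose'[of k 2] assms(2) by auto
  define x :: nat where "x = 2 ^ 2 ^ multiplicity 2 k"
  have k: "2 ^ k = x ^ m"
    by (subst m(1)) (simp add: x_def power_mult)
  obtain j where j: "m = 2 * j + 1" using m(2) by (elim oddE)
  have x: "x > 1" unfolding x_def by (intro one_less_power) auto
  then have "x + 1 dvd 2 ^ k + 1"
    unfolding k j by (intro Suc_dvd_odd_power_plus_1) simp
  then have "x + 1 = 2 ^ k + 1"
    using assms(1) x by (auto simp: prime_nat_iff)
  then show ?thesis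
    using assms(1) unfolding fermat_primes_def x_def
    by (metis (mono_tags, lifting) mem_Collect_eq)
qed

lemma fermat_primesD:
  assumes "p \<in> fermat_primes"
  shows "prime p" "odd p" "\<exists>l. p = 2 ^ 2 ^ l + 1"
  using assms unfolding fermat_primes_def by auto

text \<open>Repeated use of (1 + z) (1 - z) = 1 - z^2 with z = 2^-(2^l).\<close>

lemma prod_fermat_telescope:
  assumes "L \<le> N"
  shows "(\<Prod>l\<in>{L..<N}. 1 + 1 / 2 ^ 2 ^ l) * (1 - 1 / 2 ^ 2 ^ L) = 1 - 1 / (2::real) ^ 2 ^ N"
  using assms
proof (induction N rule: dec_induct)
  case (step N)
  have "(\<Prod>l\<in>{L..<Suc N}. 1 + 1 / (2::real) ^ 2 ^ l) * (1 - 1 / 2 ^ 2 ^ L) =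
      (1 + 1 / 2 ^ 2 ^ N) * ((\<Prod>l\<in>{L..<N}. 1 + 1 / 2 ^ 2 ^ l) * (1 - 1 / 2 ^ 2 ^ L))"
    using step.hyps by (simp add: mult_ac)
  also have "\<dots> = (1 + 1 / 2 ^ 2 ^ N) * (1 - 1 / 2 ^ 2 ^ N)"
    unfolding step.IH ..
  also have "\<dots> = 1 - (1 / (2 ^ 2 ^ N)) ^ 2"
    by (simp add: algebra_simps power2_eq_square)
  also have "\<dots> = 1 - 1 / 2 ^ 2 ^ Suc N"
    by (simp add: power_one_over power_mult[symmetric] mult.commute)
  finally show ?case .
qed simp

text \<open>The Fermat prime with exponent l has factor 1 + 2^-(2^l). Enlarging \<open>U\<close> to
  all exponents from \<open>L\<close> up to some \<open>N\<close>, whether or not they give primes,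
  makes the product telescope.\<close>

lemma totient_ratio_fermat_le:
  assumes "finite U" "U \<subseteq> fermat_primes" "\<And>p. p \<in> U \<Longrightarrow> 2 ^ 2 ^ L + 1 \<le> p"
  shows "totient_ratio U \<le> 2 ^ 2 ^ L / (2 ^ 2 ^ L - 1)"
proof -
  define h :: "nat \<Rightarrow> nat" where "h l = 2 ^ 2 ^ l + 1" for l
  obtain K where K: "U \<subseteq> {..<K}" using finite_nat_bounded[OF assms(1)] by auto
  define N where "N = max K L"
  have inj: "inj_on h A" for A
    unfolding h_def by (rule inj_onI) simp
  have "U \<subseteq> h ` {L..<N}"
  proof
    fix p assume p: "p \<in> U"
    then obtain l where l: "p = h l"
      using assms(2) fermat_primesD(3) unfolding h_def by blast
    \<comment> \<open>The exponent is smaller than the Fermat number itself, so a bound on the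
      elements of \<open>U\<close> also bounds the exponents.\<close>
    have "l < (2::nat) ^ l" "(2::nat) ^ l < 2 ^ 2 ^ l" by simp_all
    then have "l < p" unfolding l h_def by linarith
    moreover have "p < K" using p K by auto
    ultimately have "l < N" by (simp add: N_def)
    moreover have "L \<le> l" using assms(3)[OF p] unfolding l h_def by simp
    ultimately show "p \<in> h ` {L..<N}" using l by auto
  qed
  then have "totient_ratio U \<le> totient_ratio (h ` {L..<N})"
    unfolding totient_ratio_def by (intro prod_mono2) (auto simp: h_def)
  also have "\<dots> = (\<Prod>l\<in>{L..<N}. real (h l) / real (h l - 1))"
    unfolding totient_ratio_def by (simp add: prod.reindex[OF inj])
  also have "\<dots> = (\<Prod>l\<in>{L..<N}. 1 + 1 / 2 ^ 2 ^ l)"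
    by (rule prod.cong) (auto simp: h_def field_simps)
  finally have *: "totient_ratio U \<le> (\<Prod>l\<in>{L..<N}. 1 + 1 / 2 ^ 2 ^ l)" .
  have L: "(2::real) ^ 2 ^ L > 1" by (intro one_less_power) auto
  have "totient_ratio U * (1 - 1 / 2 ^ 2 ^ L) \<le>
      (\<Prod>l\<in>{L..<N}. 1 + 1 / 2 ^ 2 ^ l) * (1 - 1 / 2 ^ 2 ^ L)"
    using L by (intro mult_right_mono[OF *]) simp
  also have "\<dots> = 1 - 1 / 2 ^ 2 ^ N"
    by (rule prod_fermat_telescope) (simp add: N_def)
  also have "\<dots> \<le> 1" by simp
  finally show ?thesis using L by (simp add: field_simps)
qed

lemma prod_pred_fermat:
  assumes "finite A" "A \<subseteq> fermat_primes"
  shows "\<exists>n. (\<Prod>p\<in>A. p - 1) = (2::nat) ^ n"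
  using assms
proof (induction A rule: finite_induct)
  case empty
  show ?case by (auto intro: exI[of _ 0])
next
  case (insert p A)
  then obtain n l where "(\<Prod>p\<in>A. p - 1) = (2::nat) ^ n" "p = 2 ^ 2 ^ l + 1"
    using fermat_primesD(3) by blast
  then have "(\<Prod>p\<in>insert p A. p - 1) = (2::nat) ^ (2 ^ l + n)"
    using insert.hyps by (simp add: power_add)
  then show ?case by blast
qed

lemma totient_two_power_times_fermat:
  assumes "finite A" "A \<subseteq> fermat_primes" "a \<ge> 1"
  shows "totient (2 ^ a * \<Prod>A) = 2 ^ (a - 1) * (\<Prod>p\<in>A. p - 1)"
proof -
  have "pairwise coprime A"
    using assms(2) fermat_primesD(1) by (intro pairwiseI primes_coprime) auto
  then have "totient (\<Prod>A) = (\<Prod>p\<in>A. totient p)"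
    using totient_prod_coprime[of "\<lambda>p. p" A] by simp
  also have "\<dots> = (\<Prod>p\<in>A. p - 1)"
    using assms(2) fermat_primesD(1) by (intro prod.cong refl totient_prime) auto
  finally have "totient (\<Prod>A) = (\<Prod>p\<in>A. p - 1)" .
  moreover have "odd (\<Prod>A)"
    using assms(1,2) fermat_primesD(2) by (subst even_prod_iff) auto
  then have "coprime (2 ^ a) (\<Prod>A)" by simp
  moreover have "totient (2 ^ a) = 2 ^ (a - 1)"
    using assms(3) totient_prime_power[of 2 a] by simp
  ultimately show ?thesis by (simp add: totient_mult_coprime)
qed

lemma real_two_power_times_fermat:
  assumes "finite A" "A \<subseteq> fermat_primes" "a \<ge> 1"
  shows "real (2 ^ a * \<Prod>A) = 2 * real (totient (2 ^ a * \<Prod>A)) * totient_ratio A"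
proof -
  have "p - 1 \<noteq> 0" if "p \<in> A" for p
    using assms(2) fermat_primesD(1) prime_gt_1_nat[of p] that by auto
  then have "(\<Prod>p\<in>A. p - 1) \<noteq> 0" using assms(1) by simp
  then have "real (\<Prod>p\<in>A. p - 1) \<noteq> 0" by (simp only: of_nat_eq_0_iff not_False_eq_True)
  then have "real (\<Prod>p\<in>A. p - 1) * totient_ratio A = real (\<Prod>A)"
    unfolding totient_ratio_def prod_dividef by simp
  moreover have "real (2 ^ a) = 2 * 2 ^ (a - 1)"
    using assms(3) by (cases a) auto
  ultimately show ?thesis
    unfolding totient_two_power_times_fermat[OF assms] by simp
qed

text \<open>p - 1 divides a power of 2, so p has the form 2^k + 1 and primality forces k to be a
  power of 2.\<close>

lemma odd_prime_factor_fermat: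
  assumes "y > 0" "totient y = 2 ^ n" "p \<in> prime_factors y - {2}"
  shows "p \<in> fermat_primes"
proof -
  note p = odd_prime_factors[OF assms(3)]
  have "p - 1 dvd 2 ^ n"
    using prod_pred_prime_factors_dvd_totient[OF assms(1), of "{p}"] assms(2,3) by simp
  then obtain k where k: "p - 1 = 2 ^ k"
    using divides_primepow_nat[of 2 "p - 1" n] by auto
  then have "p = 2 ^ k + 1" using p(3) by simp
  moreover have "k > 0" using k p(3) by (cases k) auto
  ultimately show ?thesis using prime_two_power_plus_1_imp p(1) by metis
qed

text \<open>If \<open>y\<close> has a Fermat prime factor outside \<open>A\<close>, then the size of \<open>\<phi>(y)\<close> forces some \<open>t \<in> A\<close>
  not to divide \<open>y\<close>, and \<open>t / (t - 1)\<close> outweighs all Fermat primes from \<open>Q\<close> on together.\<close>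

lemma two_power_times_fermat_in_N2_set:
  assumes A: "finite A" "A \<subseteq> fermat_primes" and a: "a \<ge> 1"
    and beyond: "\<not> fermat_primes \<subseteq> A \<Longrightarrow> Q \<in> fermat_primes \<and> (\<forall>t\<in>A. t < Q) \<and>
      (\<forall>p\<in>fermat_primes - A. Q \<le> p) \<and> 2 ^ a \<le> Q - 1"
  shows "2 ^ a * \<Prod>A \<in> N2_set"
proof (rule N2_setI_ratio[OF _ real_two_power_times_fermat[OF A a]])
  have A_gt: "p - 1 > 0" if "p \<in> fermat_primes" for p
    using fermat_primesD(1)[OF that] prime_gt_1_nat[of p] by simp
  show "2 ^ a * \<Prod>A > 0"
    using A A_gt by (force intro!: prod_pos)
  fix y :: nat assume y: "y > 0" "totient y = totient (2 ^ a * \<Prod>A)"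
  define P where "P = prime_factors y - {2}"
  have ty: "totient y = 2 ^ (a - 1) * (\<Prod>p\<in>A. p - 1)"
    using y(2) totient_two_power_times_fermat[OF A a] by simp
  obtain n where "(\<Prod>p\<in>A. p - 1) = (2::nat) ^ n" using prod_pred_fermat[OF A] by auto
  then have "totient y = 2 ^ (a - 1 + n)" using ty by (simp add: power_add)
  then have PF: "P \<subseteq> fermat_primes"
    unfolding P_def using odd_prime_factor_fermat[OF y(1)] by blast
  have finP: "finite P" unfolding P_def by simp
  have "totient_ratio P \<le> totient_ratio A"
  proof (cases "P \<subseteq> A")
    case True
    then show ?thesis using A fermat_primesD(1) by (intro totient_ratio_mono) auto
  next
    case False
    then obtain p where p: "p \<in> P" "p \<notin> A" by auto
    then have Q: "Q \<in> fermat_primes" "\<And>t. t \<in> A \<Longrightarrow> t < Q"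
        "\<And>p. p \<in> fermat_primes - A \<Longrightarrow> Q \<le> p" "2 ^ a \<le> Q - 1"
      using beyond PF by auto
    \<comment> \<open>Otherwise the additional factor p - 1 must fit into 2^(a - 1), which is less
      than Q - 1 \<le> p - 1.\<close>
    have "\<not> A \<subseteq> P"
    proof
      assume "A \<subseteq> P"
      then have "(\<Prod>p\<in>insert p A. p - 1) dvd totient y"
        using p unfolding P_def by (intro prod_pred_prime_factors_dvd_totient y(1)) auto
      then have "(\<Prod>p\<in>insert p A. p - 1) \<le> totient y"
        using y(1) by (intro dvd_imp_le) auto
      then have "(p - 1) * (\<Prod>p\<in>A. p - 1) \<le> 2 ^ (a - 1) * (\<Prod>p\<in>A. p - 1)"
        using p A(1) unfolding ty by simp
      moreover have "(\<Prod>p\<in>A. p - 1) > 0"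
        using A A_gt by (force intro!: prod_pos)
      ultimately have "p - 1 \<le> 2 ^ (a - 1)" by simp
      also have "(2::nat) ^ (a - 1) < 2 ^ a" using a by simp
      also have "\<dots> \<le> Q - 1" by (rule Q(4))
      also have "\<dots> \<le> p - 1" using Q(3)[of p] p PF by (intro diff_le_mono) auto
      finally show False by simp
    qed
    then obtain t where t: "t \<in> A" "t \<notin> P" by auto
    obtain L where L: "Q = 2 ^ 2 ^ L + 1" using fermat_primesD(3)[OF Q(1)] by auto
    have "totient_ratio (P - A) \<le> 2 ^ 2 ^ L / (2 ^ 2 ^ L - 1)"
      using PF Q(3) unfolding L by (intro totient_ratio_fermat_le finite_Diff[OF finP]) auto
    \<comment> \<open>The telescoped bound is x / (x - 1) at x = Q - 1, and every t < Q satisfies t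
      \<le> Q - 1, so the monotonicity of x / (x - 1) applies exactly.\<close>
    also have "\<dots> = real (Q - 1) / real (Q - 1 - 1)"
      unfolding L by (simp add: of_nat_diff)
    also have "\<dots> \<le> real t / real (t - 1)"
      using A_gt[of t] t A Q(2)[of t] by (intro divide_pred_antimono) auto
    finally have *: "totient_ratio (P - A) \<le> real t / real (t - 1)" .
    have **: "totient_ratio (P \<inter> A) \<le> totient_ratio (A - {t})"
      using t A fermat_primesD(1) by (intro totient_ratio_mono) auto
    \<comment> \<open>Exchange step: all primes of \<open>P\<close> outside \<open>A\<close> are
      traded for the single missing t.\<close>
    have "totient_ratio P = totient_ratio (P - A) * totient_ratio (P \<inter> A)"
      unfolding totient_ratio_def
      using prod.Int_Diff[OF finP, of "\<lambda>p. real p / real (p - 1)" A] by (simp add: mult.commute)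
    also have "\<dots> \<le> real t / real (t - 1) * totient_ratio (A - {t})"
      by (intro mult_mono * **) (auto simp: totient_ratio_def intro!: prod_nonneg)
    also have "\<dots> = totient_ratio A"
      using totient_ratio_insert[of "A - {t}" t] A(1) t(1) by (simp add: insert_absorb)
    finally show ?thesis .
  qed
  then show "totient_ratio (prime_factors y - {2}) \<le> totient_ratio A"
    unfolding P_def .
qed

section \<open>Numbering of the Fermat primes\<close>

lemma bij_betw_enumerate_nat:
  fixes S :: "nat set"
  shows "bij_betw (enumerate S) {n. finite S \<longrightarrow> n < card S} S"
  using bij_enumerate[of S] finite_bij_enumerate[of S]
  by (cases "finite S") (auto simp: lessThan_def)

lemma enumerate_less_enumerate:
  fixes S :: "nat set"
  assumes "m < n" "finite S \<longrightarrow> n < card S"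
  shows "enumerate S m < enumerate S n"
  using assms enumerate_mono finite_enumerate_mono by blast

text \<open>\<open>Suc\<close> translates between indices from 1 and the indices from 0 of
  \<open>enumerate\<close>; the implication treats finitely and infinitely many Fermat primes at
  once.\<close>

lemma H_set_altdef: "H_set = Suc ` {n. finite fermat_primes \<longrightarrow> n < card fermat_primes}"
proof (intro equalityI subsetI)
  fix k assume "k \<in> H_set"
  then show "k \<in> Suc ` {n. finite fermat_primes \<longrightarrow> n < card fermat_primes}"
    by (cases k) (auto simp: H_set_def)
qed (auto simp: H_set_def)

lemma bij_betw_nth_fermat_prime: "bij_betw nth_fermat_prime H_set fermat_primes"
proof -
  have "bij_betw (nth_fermat_prime \<circ> Suc)
      {n. finite fermat_primes \<longrightarrow> n < card fermat_primes} fermat_primes"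
    using bij_betw_enumerate_nat[of fermat_primes]
    by (simp add: nth_fermat_prime_def[abs_def] comp_def)
  then show ?thesis
    unfolding H_set_altdef by (subst (asm) bij_betw_comp_iff[symmetric, of Suc])
      (auto simp: bij_betw_def)
qed

lemma nth_fermat_prime_less:
  assumes "i \<in> H_set" "j \<in> H_set" "i < j"
  shows "nth_fermat_prime i < nth_fermat_prime j"
  unfolding nth_fermat_prime_def
  using assms by (intro enumerate_less_enumerate) (auto simp: H_set_def)

lemma H_set_downward: "k \<in> H_set \<Longrightarrow> 1 \<le> i \<Longrightarrow> i \<le> k \<Longrightarrow> i \<in> H_set"
  by (auto simp: H_set_def)

text \<open>Exponentiating removes the logarithm, and injectivity of the numbering turns the indexed
  product into one over a set, the form required by
  \<open>two_power_times_fermat_in_N2_set\<close>.\<close>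

lemma F_set_cases:
  assumes "x \<in> F_set"
  obtains a k where "x = 2 ^ a * \<Prod>(nth_fermat_prime ` {1..k})" "k \<in> H_set" "a \<ge> 1"
    "k + 1 \<in> H_set \<Longrightarrow> 2 ^ a \<le> nth_fermat_prime (k + 1) - 1"
    "nth_fermat_prime ` {1..k} \<subseteq> fermat_primes"
proof -
  obtain a k where x: "x = 2 ^ a * (\<Prod>i = 1..k. nth_fermat_prime i)"
    and k: "k \<in> H_set" and a: "a \<ge> 1"
    and l: "k + 1 \<in> H_set \<Longrightarrow> real a \<le> log 2 (real (nth_fermat_prime (k + 1)) - 1)"
    using assms unfolding F_set_def by auto
  have sub: "{1..k} \<subseteq> H_set" using H_set_downward[OF k] by auto
  have "inj_on nth_fermat_prime {1..k}"
    using bij_betw_nth_fermat_prime sub unfolding bij_betw_def by (metis inj_on_subset)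
  then have "\<Prod>(nth_fermat_prime ` {1..k}) = (\<Prod>i = 1..k. nth_fermat_prime i)"
    by (simp add: prod.reindex)
  moreover have "2 ^ a \<le> nth_fermat_prime (k + 1) - 1" if "k + 1 \<in> H_set"
  proof -
    have "prime (nth_fermat_prime (k + 1))"
      using bij_betwE[OF bij_betw_nth_fermat_prime] that fermat_primesD(1) by blast
    then have gt: "nth_fermat_prime (k + 1) > 1" by (rule prime_gt_1_nat)
    then have "2 powr real a \<le> real (nth_fermat_prime (k + 1)) - 1"
      using l[OF that] by (subst (asm) le_log_iff) auto
    then have "real (2 ^ a) \<le> real (nth_fermat_prime (k + 1) - 1)"
      using gt by (simp add: powr_realpow of_nat_diff)
    then show ?thesis by linarith
  qed
  moreover have "nth_fermat_prime ` {1..k} \<subseteq> fermat_primes"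
    using bij_betwE[OF bij_betw_nth_fermat_prime] sub by blast
  ultimately show ?thesis using that x k a by metis
qed

lemma F_set_subset_N2_set: "F_set \<subseteq> N2_set"
proof
  fix x assume "x \<in> F_set"
  then obtain a k where x: "x = 2 ^ a * \<Prod>(nth_fermat_prime ` {1..k})" and k: "k \<in> H_set"
    and a: "a \<ge> 1" and l: "k + 1 \<in> H_set \<Longrightarrow> 2 ^ a \<le> nth_fermat_prime (k + 1) - 1"
    and sub: "nth_fermat_prime ` {1..k} \<subseteq> fermat_primes"
    by (rule F_set_cases) blast
  note bij = bij_betw_nth_fermat_prime
  let ?A = "nth_fermat_prime ` {1..k}" and ?Q = "nth_fermat_prime (k + 1)"
  \<comment> \<open>A Fermat prime outside the first k has an index beyond k, so the next Fermat
    prime exists and is the least one left.\<close>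
  have outside: "k + 1 \<in> H_set \<and> ?Q \<le> p" if p: "p \<in> fermat_primes - ?A" for p
  proof -
    obtain j where j: "j \<in> H_set" "p = nth_fermat_prime j"
      using p bij unfolding bij_betw_def by auto
    then have "j \<ge> k + 1" using p by (force simp: H_set_def)
    then have "k + 1 \<in> H_set" using H_set_downward[OF j(1), of "k + 1"] by simp
    moreover from this have "?Q \<le> p"
      using nth_fermat_prime_less[of "k + 1" j] j \<open>j \<ge> k + 1\<close> by (cases "j = k + 1") auto
    ultimately show ?thesis ..
  qed
  show "x \<in> N2_set"
    unfolding x
  proof (rule two_power_times_fermat_in_N2_set[OF _ sub a, where Q = ?Q])
    assume "\<not> fermat_primes \<subseteq> ?A"
    then have kH: "k + 1 \<in> H_set" using outside by blast
    moreover have "t < ?Q" if "t \<in> ?A" for t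
      using that H_set_downward[OF k] kH by (auto intro!: nth_fermat_prime_less)
    ultimately show "?Q \<in> fermat_primes \<and> (\<forall>t\<in>?A. t < ?Q) \<and>
        (\<forall>p\<in>fermat_primes - ?A. ?Q \<le> p) \<and> 2 ^ a \<le> ?Q - 1"
      using outside l bij_betwE[OF bij] by blast
  qed simp
qed

lemma F_set_le_4_totient:
  assumes "x \<in> F_set"
  shows "x \<le> 4 * totient x"
proof -
  obtain a k where x: "x = 2 ^ a * \<Prod>(nth_fermat_prime ` {1..k})" and a: "a \<ge> 1"
    and sub: "nth_fermat_prime ` {1..k} \<subseteq> fermat_primes"
    using assms by (rule F_set_cases) blast
  let ?A = "nth_fermat_prime ` {1..k}"
  have "2 ^ 2 ^ 0 + 1 \<le> p" if "p \<in> fermat_primes" for p :: nat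
    using fermat_primesD(1,2)[OF that] prime_ge_2_nat[of p] by (cases "p = 2") auto
  \<comment> \<open>With exponent 0 the smallest Fermat prime is 3 and the bound is 2.\<close>
  then have "totient_ratio ?A \<le> 2 ^ 2 ^ 0 / (2 ^ 2 ^ 0 - 1)"
    using sub by (intro totient_ratio_fermat_le) auto
  then have "2 * real (totient x) * totient_ratio ?A \<le> 2 * real (totient x) * 2"
    by (intro mult_left_mono) auto
  moreover have "real x = 2 * real (totient x) * totient_ratio ?A"
    unfolding x by (rule real_two_power_times_fermat[OF _ sub a]) simp
  ultimately show ?thesis by linarith
qed

text \<open>If there are finitely many Fermat primes, taking all of them leaves \<open>a\<close>
  unbounded. Otherwise a = 1 is always admissible, because the next Fermat prime is at least 3, and
  \<open>k\<close> varies.\<close>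

lemma infinite_F_set: "infinite F_set"
proof -
  have "3 \<in> fermat_primes"
    unfolding fermat_primes_def by (auto intro!: exI[of _ 0])
  have pos: "nth_fermat_prime i > 1" if "i \<in> H_set" for i
    using bij_betwE[OF bij_betw_nth_fermat_prime] that fermat_primesD(1) prime_gt_1_nat by blast
  show ?thesis
  proof (cases "finite fermat_primes")
    case True
    let ?k = "card fermat_primes"
    let ?c = "\<Prod>i = 1..?k. nth_fermat_prime i"
    \<comment> \<open>The Fermat prime 3 guarantees that the number of Fermat primes is at least 1,
      as indices start there.\<close>
    have k: "?k \<in> H_set" "?k + 1 \<notin> H_set"
      using True \<open>3 \<in> fermat_primes\<close> by (auto simp: H_set_def Suc_le_eq card_gt_0_iff)
    have "nth_fermat_prime i > 0" if "i \<in> {1..?k}" for i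
      using pos[OF H_set_downward[OF k(1)]] that by fastforce
    then have "?c > 0" by (intro prod_pos) auto
    then have "inj (\<lambda>a. 2 ^ (a + 1) * ?c)" by (intro injI) auto
    then have "infinite (range (\<lambda>a. 2 ^ (a + 1) * ?c))" by (rule range_inj_infinite)
    moreover have "range (\<lambda>a. 2 ^ (a + 1) * ?c) \<subseteq> F_set"
    proof (rule image_subsetI)
      show "2 ^ (a + 1) * ?c \<in> F_set" for a
        unfolding F_set_def using k
        by (intro CollectI exI[of _ "a + 1"] exI[of _ ?k]) auto
    qed
    ultimately show ?thesis by (rule infinite_super[rotated])
  next
    case False
    have H: "k \<in> H_set" if "k \<ge> 1" for k using that False by (simp add: H_set_def)
    let ?f = "\<lambda>k. 2 ^ 1 * (\<Prod>i = 1..Suc k. nth_fermat_prime i)"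
    have "strict_mono ?f"
    proof (rule strict_mono_Suc_iff[THEN iffD2, rule_format])
      fix k
      have "(\<Prod>i = 1..Suc k. nth_fermat_prime i) > 0"
        using pos H by (intro prod_pos) (metis atLeastAtMost_iff less_trans zero_less_one)
      moreover have "nth_fermat_prime (Suc (Suc k)) > 1" by (intro pos H) simp
      ultimately show "?f k < ?f (Suc k)" by simp
    qed
    then have "infinite (range ?f)" by (intro range_inj_infinite strict_mono_imp_inj_on)
    moreover have "range ?f \<subseteq> F_set"
    proof (rule image_subsetI)
      fix k :: nat
      have "nth_fermat_prime (Suc k + 1) \<in> fermat_primes"
        using bij_betwE[OF bij_betw_nth_fermat_prime] H[of "Suc k + 1"] by simp
      then have "odd (nth_fermat_prime (Suc k + 1))" by (rule fermat_primesD(2))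
      moreover have "nth_fermat_prime (Suc k + 1) > 1" by (intro pos H) simp
      ultimately have "nth_fermat_prime (Suc k + 1) \<ge> 3" by presburger
      then have "real 1 \<le> log 2 (real (nth_fermat_prime (Suc k + 1)) - 1)"
        by (subst le_log_iff) auto
      then show "?f k \<in> F_set"
        unfolding F_set_def using H[of "Suc k"]
        by (intro CollectI exI[of _ 1] exI[of _ "Suc k"]) auto
    qed
    ultimately show ?thesis by (rule infinite_super[rotated])
  qed
qed

theorem theorem1p5:
  shows "infinite K_max_set \<and> K_max_set \<subseteq> N2_set \<and> finite (K_max_set \<inter> N1_set)
    \<and> infinite R_set \<and> R_set \<subseteq> N2_set \<and> finite (R_set \<inter> N1_set)
    \<and> infinite F_set \<and> F_set \<subseteq> N2_set \<and> finite (F_set \<inter> N1_set)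
    \<and> infinite K_min_set \<and> K_min_set \<subseteq> N3_set
    \<and> infinite {n \<in> K_min_set. n > 1 \<and> \<not> prime n}"
proof -
  have "K_max_set \<subseteq> N2_set"
    unfolding K_max_set_def using K_big_in_N2_set by blast
  moreover have "K_min_set \<subseteq> N3_set"
    unfolding K_min_set_def using k_small_in_N3_set by blast
  moreover have "infinite K_min_set"
    by (rule infinite_super[OF _ infinite_composite_K_min]) blast
  moreover have "finite (K_max_set \<inter> N1_set)" "finite (R_set \<inter> N1_set)" "finite (F_set \<inter> N1_set)"
    using K_max_set_le_4_totient R_set_le_4_totient F_set_le_4_totient
    by (simp_all add: finite_inter_N1_set)
  ultimately show ?thesis
    using infinite_K_max_set infinite_R_set R_set_subset_N2_set infinite_F_set
      F_set_subset_N2_set infinite_composite_K_min by blast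
qed

end
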